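(* Fix an integer $k\ge0$ and let $f(x)=\sum_{P\in\mathcal{N}_k}x^{\mathrm{size}(P)}$. Then \[ \Phi\big(f(x)\big)=\sum_{P\in\mathcal{N}_k}x^{\mathrm{size}(P)}y^{\mathrm{pa}(P)}, \] where $\mathrm{pa}(P)$ is the number of pyramid ascents of $P$.
   Context: The run transform is $\Phi\big(f(x)\big)=\frac{1-x}{1-xy}\,f\!\left(\frac{x(1-x)}{1-xy}\right)$. A $U$-$D$ path is a lattice path of upsteps $U=(1,1)$ and downsteps $D=(1,-1)$. $\mathcal{N}_k$ is the set of $U$-$D$ paths with $n$ upsteps and $n+k$ downsteps for some $n\ge0$ that never go below the horizontal line through the terminal vertex. The size of a path is its number of downsteps. An ascent is a maximal subpath of the form $U^i$ ($i\ge1$); a pyramid is a maximal subpath of the form $U^iD^i$ ($i\ge1$); a pyramid ascent is an ascent that is the first half of a pyramid. *)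

theory Defs
  imports "HOL-Computational_Algebra.Formal_Power_Series"
begin

datatype step = U | D

text \<open>A lattice path is given, up to translation, by its word of steps.\<close>

type_synonym path = "step list"

fun rise :: "step \<Rightarrow> int" where
  "rise U = 1"
| "rise D = -1"

definition height :: "path \<Rightarrow> int" where
  "height P = sum_list (map rise P)"

text \<open>The vertices of \<open>P\<close> are the endpoints of its prefixes \<open>take m P\<close>;
  the terminal vertex has height \<open>height P\<close> above the initial one.\<close>

definition \<N> :: "nat \<Rightarrow> path set" where
  "\<N> k = {P. (\<exists>n. count_list P U = n \<and> count_list P D = n + k) \<and>
             (\<forall>m\<le>length P. height P \<le> height (take m P))}"

definition path_size :: "path \<Rightarrow> nat" where
  "path_size P = count_list P D"

definition subpath_at :: "path \<Rightarrow> nat \<Rightarrow> path \<Rightarrow> bool" where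
  "subpath_at P p w \<longleftrightarrow> (\<exists>as bs. P = as @ w @ bs \<and> length as = p)"

text \<open>The occurrence of \<open>w\<close> at position \<open>p\<close> is not properly contained in another occurrence
  of a word of \<open>W\<close>.\<close>

definition maximal_subpath_at :: "path set \<Rightarrow> path \<Rightarrow> nat \<Rightarrow> path \<Rightarrow> bool" where
  "maximal_subpath_at W P p w \<longleftrightarrow> w \<in> W \<and> subpath_at P p w \<and>
     (\<forall>q v. v \<in> W \<and> subpath_at P q v \<and> q \<le> p \<and> p + length w \<le> q + length v
        \<longrightarrow> q = p \<and> v = w)"

definition ascent_at :: "path \<Rightarrow> nat \<Rightarrow> nat \<Rightarrow> bool" where
  "ascent_at P p i \<longleftrightarrow> i \<ge> 1 \<and>
     maximal_subpath_at {replicate j U |j. j \<ge> 1} P p (replicate i U)"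

definition pyramid_at :: "path \<Rightarrow> nat \<Rightarrow> nat \<Rightarrow> bool" where
  "pyramid_at P p i \<longleftrightarrow> i \<ge> 1 \<and>
     maximal_subpath_at {replicate j U @ replicate j D |j. j \<ge> 1} P p
       (replicate i U @ replicate i D)"

text \<open>The first half of the pyramid \<open>U\<^sup>iD\<^sup>i\<close> at position \<open>p\<close> is the subpath \<open>U\<^sup>i\<close> at position \<open>p\<close>.\<close>

definition pyramid_ascents :: "path \<Rightarrow> (nat \<times> nat) set" where
  "pyramid_ascents P = {(p, i). ascent_at P p i \<and> pyramid_at P p i}"

definition pa :: "path \<Rightarrow> nat" where
  "pa P = card (pyramid_ascents P)"

text \<open>The formal sum of \<open>w P * x ^ s P\<close> over \<open>P \<in> A\<close>, meaningful when only finitely many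
  \<open>P \<in> A\<close> have any given \<open>s P\<close> (for \<open>\<N> k\<close> and \<open>path_size\<close> see \<open>finite_\<N>_path_size\<close> below).\<close>

definition gen_series :: "'p set \<Rightarrow> ('p \<Rightarrow> nat) \<Rightarrow> ('p \<Rightarrow> 'a) \<Rightarrow> 'a::comm_monoid_add fps" where
  "gen_series A s w = Abs_fps (\<lambda>n. \<Sum>P\<in>{P \<in> A. s P = n}. w P)"

text \<open>Bivariate series live in \<open>\<rat>[[y]][[x]]\<close>; \<open>X\<close> and \<open>Y\<close> are the indeterminates \<open>x\<close> and \<open>y\<close>.\<close>

abbreviation X :: "rat fps fps" where
  "X \<equiv> fps_X"

abbreviation Y :: "rat fps fps" where
  "Y \<equiv> fps_const fps_X"

definition embed :: "rat fps \<Rightarrow> rat fps fps" where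
  "embed f = Abs_fps (\<lambda>n. fps_const (fps_nth f n))"

definition run_transform :: "rat fps \<Rightarrow> rat fps fps" ("\<Phi>") where
  "\<Phi> f = (1 - X) / (1 - X * Y) * (embed f oo (X * (1 - X) / (1 - X * Y)))"

lemma finite_\<N>_path_size: "finite {P \<in> \<N> k. path_size P = n}"
proof (rule finite_subset)
  have len: "length P = count_list P U + count_list P D" for P
  proof (induction P)
    case (Cons a P)
    then show ?case by (cases a) auto
  qed simp
  show "{P \<in> \<N> k. path_size P = n} \<subseteq> {P. set P \<subseteq> {U, D} \<and> length P \<le> 2 * n}"
    using step.exhaust by (auto simp: \<N>_def path_size_def len)
  show "finite {P. set P \<subseteq> {U, D} \<and> length P \<le> 2 * n}"
    by (rule finite_lists_length_le) simp
qed

text \<open>The coefficient ring \<open>\<rat>[[y]]\<close> is not a field, so the usual facts on division of power series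
  do not apply directly; division by the unit \<open>1 - X * Y\<close> is nevertheless the true quotient.\<close>

lemma divide_one_minus_xy: "(f / (1 - X * Y)) * (1 - X * Y) = f"
proof -
  have nz: "fps_nth (1 - X * Y) 0 = 1" by simp
  then have sd: "subdegree (1 - X * Y) = 0" by (simp add: subdegree_eq_0)
  have "inverse (1 - X * Y) * (1 - X * Y) = 1"
    using fps_right_inverse[of "1 - X * Y" 1] nz
    by (simp add: fps_inverse_def fps_lr_inverse_one_one mult.commute)
  then show ?thesis
    using sd by (simp add: fps_divide_def mult.assoc)
qed

end

theory Submission
  imports Defs
begin

text \<open>
  Let \<open>F\<^sub>k\<close> be the series of \<open>x\<^bsup>size\<^esup> t\<^bsup>pa\<^esup>\<close> over \<open>\<N> k\<close>. A path that stays weakly above its terminal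
  vertex loses or gains no pyramid ascent when another path is appended to it, so cutting at the
  first passage gives \<open>F\<^sub>k = x\<^sup>k F\<^sub>0\<^bsup>k+1\<^esup>\<close>. Passing from a nonempty Dyck path \<open>Q\<close> to \<open>U Q D\<close> destroys a
  pyramid ascent exactly when \<open>Q = U\<^sup>i D\<^sup>i R\<close> with \<open>R\<close> nonempty; the first-return decomposition then
  yields \<open>(1 - x t) F\<^sub>0 = 1 - x + x (1 - x t) F\<^sub>0\<^sup>2\<close>. With \<open>u = (1 - x) / (1 - x y)\<close> and \<open>z = x u\<close>, both
  \<open>F\<^sub>0\<close> at \<open>t = y\<close> and \<open>u C(z)\<close>, where \<open>C\<close> is \<open>F\<^sub>0\<close> at \<open>t = 1\<close>, solve \<open>w = u + x w\<^sup>2\<close>, which has a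
  unique solution.
\<close>

unbundle fps_syntax

section \<open>Pyramid ascents by recursion along the path\<close>

definition starts_with_pyramid :: "path \<Rightarrow> bool" where
  "starts_with_pyramid P \<longleftrightarrow> (\<exists>i\<ge>1. \<exists>R. P = replicate i U @ replicate i D @ R)"

text \<open>\<open>inner_pa\<close> counts the pyramid ascents that do not start at the initial vertex.\<close>

fun inner_pa :: "path \<Rightarrow> nat" where
  "inner_pa [] = 0"
| "inner_pa (U # P) = inner_pa P"
| "inner_pa (D # P) = inner_pa P + of_bool (starts_with_pyramid P)"

lemma nth_subpath_at:
  assumes "subpath_at P p w" "p \<le> m" "m < p + length w"
  shows "P ! m = w ! (m - p)"
  using assms by (auto simp: subpath_at_def nth_append)

text \<open>Since U^i is followed by a downstep, an ascent can only be enlarged to the left; a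
  larger pyramid around U^i D^i shares its peak and so would also extend to the left. Absence of an
  upstep just before \<open>p\<close> thus expresses maximality of the ascent and implies that of
  the pyramid.\<close>

lemma pyramid_ascents_eq:
  "pyramid_ascents P = {(p, i). i \<ge> 1 \<and> (\<exists>as bs. P = as @ replicate i U @ replicate i D @ bs \<and>
     length as = p \<and> (as = [] \<or> last as = D))}" (is "_ = ?S")
proof (intro equalityI subrelI)
  fix p i
  assume "(p, i) \<in> pyramid_ascents P"
  then have i: "i \<ge> 1" and asc: "ascent_at P p i" and pyr: "pyramid_at P p i"
    by (auto simp: pyramid_ascents_def ascent_at_def)
  from pyr obtain as bs where P: "P = as @ replicate i U @ replicate i D @ bs" "length as = p"
    by (auto simp: pyramid_at_def maximal_subpath_at_def subpath_at_def)
  have "last as = D" if ne: "as \<noteq> []"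
  proof (rule ccontr)
    assume "last as \<noteq> D"
    then have "last as = U"
      by (cases "last as") auto
    then obtain as' where as: "as = as' @ [U]"
      using ne by (cases as rule: rev_cases) auto
    have "subpath_at P (p - 1) (replicate (Suc i) U)"
      unfolding subpath_at_def
    proof (intro exI conjI)
      show "P = as' @ replicate (Suc i) U @ (replicate i D @ bs)" "length as' = p - 1"
        using P by (simp_all add: as)
    qed
    moreover have "replicate (Suc i) U \<in> {replicate j U |j. j \<ge> 1}"
      by (intro CollectI exI[of _ "Suc i"]) auto
    moreover have "p + length (replicate i U) \<le> p - 1 + length (replicate (Suc i) U)"
      by simp
    ultimately have "p - 1 = p"
      using asc diff_le_self unfolding ascent_at_def maximal_subpath_at_def by blast
    with P(2) show False
      by (simp add: as)
  qed
  then show "(p, i) \<in> ?S"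
    using i P by blast
next
  fix p i
  assume "(p, i) \<in> ?S"
  then obtain as bs where i: "i \<ge> 1" and as: "as = [] \<or> last as = D"
    and P: "P = as @ replicate i U @ replicate i D @ bs" and p: "length as = p"
    by blast
  have before: "P ! (length as - 1) = D" if "as \<noteq> []"
    using as that by (simp add: P nth_append last_conv_nth)
  \<comment> \<open>These are the steps on both sides of the peak; they fix its position in any
    competing ascent or pyramid.\<close>
  have up: "P ! (length as + i - 1) = U" and down: "P ! (length as + i) = D"
    using i by (auto simp: P nth_append)
  have "ascent_at P (length as) i"
    unfolding ascent_at_def maximal_subpath_at_def
  proof (intro conjI allI impI; (elim conjE)?)
    show "subpath_at P (length as) (replicate i U)"
      unfolding subpath_at_def P by blast
    fix q v
    assume v: "v \<in> {replicate j U |j. j \<ge> 1}" "subpath_at P q v" "q \<le> length as"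
      "length as + length (replicate i U) \<le> q + length v"
    then obtain j where j: "v = replicate j U"
      by blast
    have U: "P ! m = U" if "q \<le> m" "m < q + j" for m
      using nth_subpath_at[OF v(2) that(1)] that by (simp add: j)
    show q: "q = length as"
    proof (rule ccontr)
      assume "q \<noteq> length as"
      with v i have "q \<le> length as - 1" "length as - 1 < q + j" "as \<noteq> []"
        by (auto simp: j)
      with U before show False
        by fastforce
    qed
    have "\<not> length as + i < q + j"
      using U[of "length as + i"] down q by auto
    then show "v = replicate i U"
      using v j q by simp
  qed (use i in auto)
  moreover have "pyramid_at P (length as) i"
    unfolding pyramid_at_def maximal_subpath_at_def
  proof (intro conjI allI impI; (elim conjE)?)
    show "subpath_at P (length as) (replicate i U @ replicate i D)"
      unfolding subpath_at_def P by (metis append.assoc)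
    fix q v
    assume v: "v \<in> {replicate j U @ replicate j D |j. j \<ge> 1}" "subpath_at P q v" "q \<le> length as"
      "length as + length (replicate i U @ replicate i D) \<le> q + length v"
    then obtain j where j: "v = replicate j U @ replicate j D"
      by blast
    have nth: "P ! m = (if m < q + j then U else D)" if "q \<le> m" "m < q + 2 * j" for m
      using nth_subpath_at[OF v(2) that(1)] that by (auto simp: j nth_append)
    \<comment> \<open>The competing pyramid covers both steps beside the peak, reading
      \<open>U\<close> and then \<open>D\<close> there, so it must turn at the same vertex.\<close>
    have "q \<le> length as + i - 1" "q \<le> length as + i" "length as + i < q + 2 * j"
      using v(3,4) i by (auto simp: j)
    then have "length as + i - 1 < q + j" "\<not> length as + i < q + j"
      using nth[of "length as + i - 1"] nth[of "length as + i"] up down by (auto split: if_splits)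
    then have peak: "length as + i = q + j"
      by simp
    show q: "q = length as"
    proof (rule ccontr)
      assume "q \<noteq> length as"
      with v i peak have "q \<le> length as - 1" "length as - 1 < q + j" "as \<noteq> []"
        by auto
      with nth[of "length as - 1"] before show False
        by simp
    qed
    show "v = replicate i U @ replicate i D"
      using peak q j by simp
  qed (use i in auto)
  ultimately show "(p, i) \<in> pyramid_ascents P"
    by (simp add: pyramid_ascents_def p)
qed

text \<open>For \<open>i \<ge> 1\<close> a downstep follows the first \<open>i\<close> upsteps, so
  \<open>i\<close> is the length of the initial run of upsteps.\<close>

lemma replicate_UD_inject:
  assumes "replicate i U @ replicate i D @ R = replicate j U @ replicate j D @ R'" "i \<ge> 1" "j \<ge> 1"
  shows "i = j"
proof -
  have tw: "takeWhile ((=) U) (replicate i U @ replicate i D @ R) = replicate i U" if "i \<ge> 1" for i R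
    using that by (cases i) (auto simp: takeWhile_append)
  show ?thesis
    using assms tw by (metis length_replicate)
qed

text \<open>Prepending \<open>D\<close> shifts all pyramid ascents; prepending \<open>U\<close>
  shifts those away from the initial vertex, while an ascent at that vertex merges with the new
  step. This is the recursion of \<open>inner_pa\<close>.\<close>

lemma pa_eq_inner_pa: "pa P = inner_pa P + of_bool (starts_with_pyramid P)"
proof -
  \<comment> \<open>\<open>T\<close> collects the pyramid ascents away from the initial vertex,
    \<open>Z\<close> the one at it, if any.\<close>
  define T where "T P = {(p, i). i \<ge> 1 \<and> (\<exists>as bs. P = as @ replicate i U @ replicate i D @ bs \<and>
     length as = p \<and> as \<noteq> [] \<and> last as = D)}" for P
  define Z where "Z P = {(p, i). i \<ge> 1 \<and> p = (0::nat) \<and>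
     (\<exists>bs. P = replicate i U @ replicate i D @ bs)}" for P
  have S: "pyramid_ascents P = T P \<union> Z P" "T P \<inter> Z P = {}" for P
    unfolding pyramid_ascents_eq T_def Z_def by auto
  have finT: "finite (T P)" for P
    by (rule finite_subset[of _ "{..length P} \<times> {..length P}"]) (auto simp: T_def)
  have Z: "finite (Z P) \<and> card (Z P) = of_bool (starts_with_pyramid P)" for P
  proof (cases "starts_with_pyramid P")
    case True
    then obtain i R where i: "i \<ge> 1" "P = replicate i U @ replicate i D @ R"
      by (auto simp: starts_with_pyramid_def)
    then have "Z P = {(0, i)}"
      unfolding Z_def by (auto dest: replicate_UD_inject)
    then show ?thesis using True by simp
  next
    case False
    then have "Z P = {}"
      by (auto simp: Z_def starts_with_pyramid_def)
    then show ?thesis using False by simp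
  qed
  have pa: "pa P = card (T P) + of_bool (starts_with_pyramid P)" for P
    unfolding pa_def S(1) using card_Un_disjoint[OF finT _ S(2)] Z by simp
  let ?s = "\<lambda>(p, i). (Suc p, i)"
  have inj: "inj_on ?s A" for A :: "(nat \<times> nat) set"
    by (auto simp: inj_on_def)
  have TD: "T (D # P) = ?s ` pyramid_ascents P" for P
  proof (intro equalityI subsetI)
    fix x assume "x \<in> T (D # P)"
    then obtain i as bs where x: "x = (length as, i)" "i \<ge> 1" "as \<noteq> []" "last as = D"
      "D # P = as @ replicate i U @ replicate i D @ bs"
      by (auto simp: T_def)
    then obtain as' where "as = D # as'"
      by (cases as) auto
    with x show "x \<in> ?s ` pyramid_ascents P"
      unfolding pyramid_ascents_eq
      by (intro image_eqI[of _ _ "(length as', i)"]) (auto split: if_splits)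
  next
    fix x assume "x \<in> ?s ` pyramid_ascents P"
    then obtain i as bs where x: "x = (Suc (length as), i)" "i \<ge> 1" "as = [] \<or> last as = D"
      "P = as @ replicate i U @ replicate i D @ bs"
      unfolding pyramid_ascents_eq by auto
    then show "x \<in> T (D # P)"
      unfolding T_def
      by (intro CollectI case_prodI2 conjI exI[of _ "D # as"] exI[of _ bs]) auto
  qed
  have TU: "T (U # P) = ?s ` T P" for P
  proof (intro equalityI subsetI)
    fix x assume "x \<in> T (U # P)"
    then obtain i as bs where x: "x = (length as, i)" "i \<ge> 1" "as \<noteq> []" "last as = D"
      "U # P = as @ replicate i U @ replicate i D @ bs"
      by (auto simp: T_def)
    then obtain as' where "as = U # as'"
      by (cases as) auto
    with x show "x \<in> ?s ` T P"
      unfolding T_def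
      by (intro image_eqI[of _ _ "(length as', i)"]) (auto split: if_splits)
  next
    fix x assume "x \<in> ?s ` T P"
    then obtain i as bs where x: "x = (Suc (length as), i)" "i \<ge> 1" "as \<noteq> []" "last as = D"
      "P = as @ replicate i U @ replicate i D @ bs"
      unfolding T_def by auto
    then show "x \<in> T (U # P)"
      unfolding T_def
      by (intro CollectI case_prodI2 conjI exI[of _ "U # as"] exI[of _ bs]) auto
  qed
  have "card (T P) = inner_pa P"
  proof (induction P rule: inner_pa.induct)
    case 1
    then show ?case by (simp add: T_def)
  next
    case (2 P)
    then show ?case by (simp add: TU card_image[OF inj])
  next
    case (3 P)
    have "card (T (D # P)) = pa P"
      unfolding TD card_image[OF inj] pa_def ..
    then show ?case using 3 pa by simp
  qed
  then show ?thesis using pa by simp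
qed

section \<open>Heights and the recursive structure of \<open>\<N> k\<close>\<close>

lemma height_simps [simp]:
  "height [] = 0" "height (s # P) = rise s + height P" "height (P @ Q) = height P + height Q"
  "height (replicate n s) = int n * rise s"
  by (auto simp: height_def sum_list_replicate)

lemma height_count: "height P = int (count_list P U) - int (count_list P D)"
proof (induction P)
  case (Cons s P)
  then show ?case by (cases s) auto
qed simp

text \<open>Stated for suffixes instead of vertices, the condition passes to tails, which allows
  recursion on the first step.\<close>

lemma \<N>_iff: "P \<in> \<N> k \<longleftrightarrow> height P = - int k \<and> (\<forall>as bs. P = as @ bs \<longrightarrow> height bs \<le> 0)"
proof -
  have "(\<forall>m\<le>length P. height P \<le> height (take m P)) \<longleftrightarrow> (\<forall>as bs. P = as @ bs \<longrightarrow> height bs \<le> 0)"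
  proof (intro iffI allI impI)
    fix as bs
    assume "\<forall>m\<le>length P. height P \<le> height (take m P)" "P = as @ bs"
    then show "height bs \<le> 0"
      by (auto dest: spec[of _ "length as"])
  next
    fix m
    assume "\<forall>as bs. P = as @ bs \<longrightarrow> height bs \<le> 0"
    then have "height (drop m P) \<le> 0"
      by (metis append_take_drop_id)
    moreover have "height P = height (take m P) + height (drop m P)"
      by (metis append_take_drop_id height_simps(3))
    ultimately show "height P \<le> height (take m P)"
      by simp
  qed
  then show ?thesis
    by (auto simp: \<N>_def height_count)
qed

lemma height_\<N>: "P \<in> \<N> k \<Longrightarrow> height P = - int k"
  by (simp add: \<N>_iff)

lemma height_suffix_\<N>: "as @ bs \<in> \<N> k \<Longrightarrow> height bs \<le> 0"
  by (simp add: \<N>_iff)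

lemma suffix_\<N>: "as @ bs \<in> \<N> k \<Longrightarrow> bs \<in> \<N> (nat (- height bs))"
  using height_suffix_\<N>[of as bs k] by (auto simp: \<N>_iff)

lemma Nil_in_\<N>_iff [simp]: "[] \<in> \<N> k \<longleftrightarrow> k = 0"
  by (auto simp: \<N>_iff)

lemma U_Cons_in_\<N>_iff [simp]: "U # P \<in> \<N> k \<longleftrightarrow> P \<in> \<N> (Suc k)"
  by (auto simp: \<N>_iff Cons_eq_append_conv)

lemma D_Cons_in_\<N>_Suc_iff [simp]: "D # P \<in> \<N> (Suc k) \<longleftrightarrow> P \<in> \<N> k"
  by (auto simp: \<N>_iff Cons_eq_append_conv)

lemma D_Cons_notin_\<N>_0 [simp]: "D # P \<notin> \<N> 0"
  using height_suffix_\<N>[of "[D]" P 0] height_\<N>[of "D # P" 0] by auto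

lemma append_in_\<N>: "P \<in> \<N> i \<Longrightarrow> Q \<in> \<N> j \<Longrightarrow> P @ Q \<in> \<N> (i + j)"
proof (induction P arbitrary: i)
  case (Cons s P)
  then show ?case
    by (cases s; cases i) fastforce+
qed simp

text \<open>The displayed \<open>D\<close> is the first passage below the starting level. After a
  first upstep the tail has to descend one level more, so it is split twice.\<close>

lemma \<N>_Suc_split:
  assumes "P \<in> \<N> (Suc k)"
  obtains Q R where "Q \<in> \<N> 0" "R \<in> \<N> k" "P = Q @ D # R"
  using assms
proof (induction P arbitrary: k thesis rule: length_induct)
  case (1 P)
  show ?case
  proof (cases P)
    case Nil
    with 1 show ?thesis by simp
  next
    case P: (Cons s P')
    show ?thesis
    proof (cases s)
      case D
      with P 1 show ?thesis
        using 1(2)[of "[]" P'] by simp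
    next
      case U
      with P 1 have "P' \<in> \<N> (Suc (Suc k))" "length P' < length P" by auto
      with 1(1) obtain Q1 R1 where 1: "Q1 \<in> \<N> 0" "R1 \<in> \<N> (Suc k)" "P' = Q1 @ D # R1"
        by metis
      then have "length R1 < length P"
        using P by simp
      with 1 "1.IH" obtain Q2 R2 where 2: "Q2 \<in> \<N> 0" "R2 \<in> \<N> k" "R1 = Q2 @ D # R2"
        by metis
      \<comment> \<open>With the first upstep put back in front, this is the part of
        \<open>P\<close> before its first passage.\<close>
      have "Q1 @ D # Q2 \<in> \<N> (0 + Suc 0)"
        using 1 2 by (intro append_in_\<N>) auto
      then show ?thesis
        using 1 2 P U "1.prems"(1)[of "U # Q1 @ D # Q2" R2] by simp
    qed
  qed
qed

text \<open>If one cut came earlier than the other, the part \<open>us\<close> of the longer path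
  after that cut would have height 1, whereas suffixes of a path in \<open>\<N> 0\<close> have
  height at most 0.\<close>

lemma \<N>_split_unique:
  assumes "Q @ D # R = Q' @ D # R'" "Q \<in> \<N> 0" "Q' \<in> \<N> 0"
  shows "Q = Q' \<and> R = R'"
proof -
  have False if "Q @ D # us = Q'" "Q \<in> \<N> 0" "Q' \<in> \<N> 0" for Q Q' us
  proof -
    have "height us \<le> 0"
      using that height_suffix_\<N>[of "Q @ [D]" us] by simp
    with that show False
      using height_\<N>[of Q 0] height_\<N>[of Q' 0] by auto
  qed
  with assms show ?thesis
    by (auto simp: append_eq_append_conv2 Cons_eq_append_conv append_eq_Cons_conv)
qed

section \<open>Pyramid ascents under concatenation and elevation\<close>

text \<open>A leading pyramid reaching beyond \<open>P\<close> would make \<open>P\<close> a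
  nonempty proper prefix of U^i D^i, hence of positive height, but \<open>P\<close> has height
  \<open>- int k\<close>.\<close>

lemma starts_with_pyramid_append:
  assumes "P \<in> \<N> k" "P \<noteq> []"
  shows "starts_with_pyramid (P @ Q) \<longleftrightarrow> starts_with_pyramid P"
proof
  assume "starts_with_pyramid (P @ Q)"
  then obtain i R where i: "i \<ge> 1" "P @ Q = (replicate i U @ replicate i D) @ R"
    by (auto simp: starts_with_pyramid_def)
  show "starts_with_pyramid P"
  proof (cases "2 * i \<le> length P")
    case True
    then have "P = replicate i U @ replicate i D @ take (length P - (i + i)) R"
      using arg_cong[OF i(2), of "take (length P)"] by simp
    then show ?thesis
      using i unfolding starts_with_pyramid_def by blast
  next
    case False
    then have "P = take (length P) (replicate i U @ replicate i D)"
      using arg_cong[OF i(2), of "take (length P)"] by simp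
    then have P: "P = replicate (min (length P) i) U @ replicate (min (length P - i) i) D"
      by (simp add: take_append)
    have "height P > 0"
      by (subst P) (use False assms(2) i in \<open>auto simp: min_def\<close>)
    then show ?thesis
      using height_\<N>[OF assms(1)] by simp
  qed
qed (auto simp: starts_with_pyramid_def)

lemma pa_simps [simp]: "pa [] = 0" "pa (D # P) = pa P"
  "pa (U # P) = inner_pa P + of_bool (starts_with_pyramid (U # P))"
  by (auto simp: pa_eq_inner_pa starts_with_pyramid_def Cons_eq_append_conv Cons_replicate_eq)

text \<open>Every suffix of \<open>P\<close> again lies in some \<open>\<N> j\<close>, so
  \<open>starts_with_pyramid_append\<close> applies all along \<open>P\<close>: no pyramid straddles
  the junction.\<close>

lemma pa_append:
  assumes "P \<in> \<N> k"
  shows "pa (P @ Q) = pa P + pa Q"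
  using assms
proof (induction P arbitrary: k)
  case (Cons s P)
  show ?case
  proof (cases s)
    case D
    with Cons.prems obtain j where "k = Suc j" "P \<in> \<N> j"
      by (cases k) auto
    with Cons.IH D show ?thesis by simp
  next
    case U
    with Cons.prems have P: "P \<in> \<N> (Suc k)" "P \<noteq> []" by auto
    then show ?thesis
      using Cons.IH[OF P(1)] starts_with_pyramid_append[OF P, of Q]
        starts_with_pyramid_append[OF Cons.prems, of Q] U
      by (auto simp: pa_eq_inner_pa[of P] pa_eq_inner_pa[of "P @ Q"])
  qed
qed simp

lemma inner_pa_append:
  assumes "P \<in> \<N> k" "P \<noteq> []"
  shows "inner_pa (P @ Q) = inner_pa P + pa Q"
  using pa_append[OF assms(1), of Q] starts_with_pyramid_append[OF assms, of Q]
  by (simp add: pa_eq_inner_pa[of P] pa_eq_inner_pa[of "P @ Q"])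

text \<open>A leading pyramid ending before the final step would take \<open>Q\<close> below its
  starting level; it therefore exhausts the elevated path. The exponent \<open>i = 0\<close> covers
  the empty \<open>Q\<close>.\<close>

lemma starts_with_pyramid_elevate:
  assumes "Q \<in> \<N> 0"
  shows "starts_with_pyramid (U # Q @ [D]) \<longleftrightarrow> (\<exists>i. Q = replicate i U @ replicate i D)"
proof
  assume "starts_with_pyramid (U # Q @ [D])"
  then obtain i R where i: "U # Q @ [D] = replicate (Suc i) U @ replicate (Suc i) D @ R"
    unfolding starts_with_pyramid_def by (metis Suc_le_D One_nat_def)
  have "R = []"
  proof (cases R rule: rev_cases)
    case (snoc R' s)
    with i have Q: "Q = (replicate i U @ replicate (Suc i) D) @ R'" by simp
    with assms have "height R' \<le> 0"
      using height_suffix_\<N> by blast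
    with Q show ?thesis
      using height_\<N>[OF assms] by simp
  qed
  with i have "Q @ [D] = (replicate i U @ replicate i D) @ [D]"
    by (simp add: replicate_append_same)
  then show "\<exists>i. Q = replicate i U @ replicate i D" by blast
next
  assume "\<exists>i. Q = replicate i U @ replicate i D"
  then obtain i where "Q = replicate i U @ replicate i D" ..
  then have "U # Q @ [D] = replicate (Suc i) U @ replicate (Suc i) D @ []"
    by (simp add: replicate_append_same)
  then show "starts_with_pyramid (U # Q @ [D])"
    unfolding starts_with_pyramid_def by (metis le_add1 plus_1_eq_Suc)
qed

lemma pyramid_in_\<N>: "replicate i U @ replicate i D \<in> \<N> 0"
proof -
  have "replicate i D \<in> \<N> i" by (induction i) auto
  moreover have "P \<in> \<N> (i + k) \<Longrightarrow> replicate i U @ P \<in> \<N> k" for P k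
    by (induction i arbitrary: k) (auto simp flip: add_Suc_right)
  ultimately show ?thesis by simp
qed

text \<open>The new first upstep swallows an ascent at the initial vertex of \<open>Q\<close>,
  leaving \<open>inner_pa Q\<close>; a new pyramid ascent arises only if the whole elevated path is
  a pyramid.\<close>

lemma pa_elevate:
  assumes "Q \<in> \<N> 0" "Q \<noteq> []"
  shows "pa (U # Q @ [D]) = inner_pa Q + of_bool (\<exists>i. Q = replicate i U @ replicate i D)"
  using inner_pa_append[OF assms, of "[D]"] starts_with_pyramid_elevate[OF assms(1)] by simp

text \<open>Under the last hypothesis a leading pyramid of \<open>Q\<close> is all of
  \<open>Q\<close>, and its ascent is replaced by that of the larger pyramid.\<close>

lemma pa_elevate_eq:
  assumes "Q \<in> \<N> 0" "Q \<noteq> []"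
    "\<not> (\<exists>i\<ge>1. \<exists>R\<in>\<N> 0 - {[]}. Q = (replicate i U @ replicate i D) @ R)"
  shows "pa (U # Q @ [D]) = pa Q"
proof -
  have "starts_with_pyramid Q \<longleftrightarrow> (\<exists>i. Q = replicate i U @ replicate i D)"
  proof
    assume "starts_with_pyramid Q"
    then obtain i R where i: "i \<ge> 1" "Q = (replicate i U @ replicate i D) @ R"
      by (auto simp: starts_with_pyramid_def)
    then have "R \<in> \<N> 0"
      using suffix_\<N>[of "replicate i U @ replicate i D" R 0] height_\<N>[OF assms(1)] assms(1) by simp
    with i assms(3) have "R = []" by blast
    with i show "\<exists>i. Q = replicate i U @ replicate i D" by auto
  next
    assume "\<exists>i. Q = replicate i U @ replicate i D"
    then show "starts_with_pyramid Q"
      using assms(2) unfolding starts_with_pyramid_def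
      by (metis One_nat_def append_Nil2 less_one not_le replicate_0)
  qed
  then show ?thesis
    using pa_elevate[OF assms(1,2)] by (simp add: pa_eq_inner_pa)
qed

lemma pa_pyramid_append:
  assumes "i \<ge> 1"
  shows "pa ((replicate i U @ replicate i D) @ R) = Suc (pa R)"
proof -
  have U: "inner_pa (replicate n U @ P) = inner_pa P" for n P by (induction n) auto
  have D: "inner_pa (replicate n D) = 0" for n
  proof (induction n)
    case (Suc n)
    have "\<not> starts_with_pyramid (replicate n D)"
      by (auto simp: starts_with_pyramid_def dest!: arg_cong[of _ _ set] split: if_splits)
    with Suc show ?case by simp
  qed simp
  have "starts_with_pyramid (replicate i U @ replicate i D)"
    using assms unfolding starts_with_pyramid_def by (metis append_Nil2)
  then have "pa (replicate i U @ replicate i D) = 1"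
    using U[of i "replicate i D"] D by (simp add: pa_eq_inner_pa)
  then show ?thesis
    using pa_append[OF pyramid_in_\<N>] by simp
qed

text \<open>The leading ascent is lost without replacement, because the nonempty \<open>R\<close>
  keeps the path from being a single pyramid.\<close>

lemma pa_elevate_pyramid_append:
  assumes "i \<ge> 1" "R \<in> \<N> 0" "R \<noteq> []"
  shows "pa (U # ((replicate i U @ replicate i D) @ R) @ [D]) = pa R"
proof -
  let ?Q = "(replicate i U @ replicate i D) @ R"
  have Q: "?Q \<in> \<N> 0"
    using append_in_\<N>[OF pyramid_in_\<N>[of i] assms(2)] by simp
  have False if "?Q = replicate j U @ replicate j D" for j
  proof -
    have "j \<ge> 1" using that assms(1) by (cases j) auto
    then have "i = j"
      using replicate_UD_inject[of i R j "[]"] that assms(1) by simp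
    with that assms(3) show False by simp
  qed
  moreover have "?Q \<noteq> []" "starts_with_pyramid ?Q"
    using assms by (auto simp: starts_with_pyramid_def)
  ultimately show ?thesis
    using pa_elevate[OF Q] pa_pyramid_append[OF assms(1), of R] pa_eq_inner_pa[of ?Q] by auto
qed

section \<open>Calculus of generating series\<close>

lemma gen_series_nth: "gen_series A s w $ n = (\<Sum>P\<in>{P \<in> A. s P = n}. w P)"
  by (simp add: gen_series_def)

lemma gen_series_bij:
  assumes "bij_betw h A B" "\<And>a. a \<in> A \<Longrightarrow> s' (h a) = s a" "\<And>a. a \<in> A \<Longrightarrow> w' (h a) = w a"
  shows "gen_series B s' w' = gen_series A s w"
proof (rule fps_ext)
  fix n
  have "bij_betw h {a \<in> A. s a = n} {b \<in> B. s' b = n}"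
    using assms(1,2) by (auto simp: bij_betw_def inj_on_def)
  then have "(\<Sum>a | a \<in> A \<and> s a = n. w' (h a)) = (\<Sum>b | b \<in> B \<and> s' b = n. w' b)"
    by (rule sum.reindex_bij_betw)
  then show "gen_series B s' w' $ n = gen_series A s w $ n"
    using assms(3) by (simp add: gen_series_nth)
qed

text \<open>Pairs of total size \<open>n\<close> are grouped by the size of the first component;
  finiteness matters because a sum over an infinite set is 0 by convention.\<close>

lemma gen_series_mult:
  fixes w :: "'p \<Rightarrow> 'a::comm_ring_1" and w' :: "'q \<Rightarrow> 'a"
  assumes "\<And>n. finite {a \<in> A. s a = n}" "\<And>n. finite {b \<in> B. s' b = n}"
  shows "gen_series A s w * gen_series B s' w' =
    gen_series (A \<times> B) (\<lambda>(a, b). s a + s' b) (\<lambda>(a, b). w a * w' b)"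
proof (rule fps_ext)
  fix n
  let ?A = "\<lambda>i. {a \<in> A. s a = i}" and ?B = "\<lambda>i. {b \<in> B. s' b = i}"
  have eq: "{x \<in> A \<times> B. (case x of (a, b) \<Rightarrow> s a + s' b) = n} = (\<Union>i\<in>{0..n}. ?A i \<times> ?B (n - i))"
    by auto
  have "(gen_series A s w * gen_series B s' w') $ n =
      (\<Sum>i=0..n. \<Sum>(a, b)\<in>?A i \<times> ?B (n - i). w a * w' b)"
    by (simp add: fps_mult_nth gen_series_nth sum_product sum.cartesian_product)
  also have "\<dots> = (\<Sum>(a, b)\<in>(\<Union>i\<in>{0..n}. ?A i \<times> ?B (n - i)). w a * w' b)"
    using assms by (intro sum.UNION_disjoint[symmetric]) auto
  finally show "(gen_series A s w * gen_series B s' w') $ n =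
      gen_series (A \<times> B) (\<lambda>(a, b). s a + s' b) (\<lambda>(a, b). w a * w' b) $ n"
    by (simp add: gen_series_nth eq)
qed

lemma gen_series_size_Suc:
  "gen_series A (\<lambda>a. Suc (s a)) w = fps_X * gen_series A s (w :: _ \<Rightarrow> 'a::comm_ring_1)"
proof (rule fps_ext)
  fix n
  show "gen_series A (\<lambda>a. Suc (s a)) w $ n = (fps_X * gen_series A s w) $ n"
    by (cases n) (simp_all add: gen_series_nth)
qed

lemma gen_series_diff:
  "gen_series A s (\<lambda>a. w a - w' a) = gen_series A s w - gen_series A s (w' :: _ \<Rightarrow> 'a::comm_ring_1)"
  by (rule fps_ext) (simp add: gen_series_nth sum_subtractf)

lemma gen_series_cmult:
  "gen_series A s (\<lambda>a. c * w a) = fps_const c * gen_series A s (w :: _ \<Rightarrow> 'a::comm_ring_1)"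
  by (rule fps_ext) (simp add: gen_series_nth sum_distrib_left)

lemma gen_series_Un:
  assumes "\<And>n. finite {a \<in> A \<union> B. s a = n}" "A \<inter> B = {}"
  shows "gen_series (A \<union> B) s w = gen_series A s w + gen_series B s w"
proof (rule fps_ext)
  fix n
  have eq: "{a \<in> A \<union> B. s a = n} = {a \<in> A. s a = n} \<union> {a \<in> B. s a = n}"
    by auto
  show "gen_series (A \<union> B) s w $ n = (gen_series A s w + gen_series B s w) $ n"
    using assms(1)[of n] assms(2) unfolding fps_add_nth gen_series_nth eq
    by (intro sum.union_disjoint) auto
qed

lemma gen_series_mono_neutral:
  assumes "\<And>n. finite {a \<in> B. s a = n}" "A \<subseteq> B" "\<And>a. a \<in> B - A \<Longrightarrow> w a = 0"
  shows "gen_series B s w = gen_series A s w"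
  unfolding gen_series_def using assms
  by (intro arg_cong[of _ _ Abs_fps] ext sum.mono_neutral_right) auto

lemma gen_series_singleton: "s a = 0 \<Longrightarrow> gen_series {a} s w = fps_const (w a)"
proof (rule fps_ext)
  fix n
  assume "s a = 0"
  then have "{x \<in> {a}. s x = n} = (if n = 0 then {a} else {})" by auto
  then show "gen_series {a} s w $ n = fps_const (w a) $ n"
    by (simp add: gen_series_nth)
qed

section \<open>Functional equations for the series of \<open>\<N> k\<close>\<close>

lemma path_size_simps [simp]: "path_size [] = 0" "path_size (U # P) = path_size P"
  "path_size (D # P) = Suc (path_size P)" "path_size (P @ Q) = path_size P + path_size Q"
  "path_size (replicate n U) = 0" "path_size (replicate n D) = n"
  by (induction n) (auto simp: path_size_def)

text \<open>The parameter \<open>t\<close> serves two values: \<open>1\<close> for the plain count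
  and \<open>fps_X\<close> for the count by pyramid ascents.\<close>

definition pa_series :: "'a::comm_ring_1 \<Rightarrow> nat \<Rightarrow> 'a fps" where
  "pa_series t k = gen_series (\<N> k) path_size (\<lambda>P. t ^ pa P)"

text \<open>First-passage decomposition: the separating \<open>D\<close> accounts for
  \<open>fps_X\<close>, and \<open>pa\<close> is additive over the two parts.\<close>

lemma pa_series_Suc: "pa_series t (Suc k) = fps_X * pa_series t 0 * pa_series t k"
proof -
  let ?h = "\<lambda>(Q, R). Q @ D # R"
  have bij: "bij_betw ?h (\<N> 0 \<times> \<N> k) (\<N> (Suc k))"
    unfolding bij_betw_def
  proof
    show "inj_on ?h (\<N> 0 \<times> \<N> k)"
      by (auto simp: inj_on_def dest: \<N>_split_unique)
    show "?h ` (\<N> 0 \<times> \<N> k) = \<N> (Suc k)"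
      using append_in_\<N>[of _ 0 "D # _" "Suc k"] by (auto elim!: \<N>_Suc_split)
  qed
  have "pa_series t (Suc k) = gen_series (\<N> 0 \<times> \<N> k)
      (\<lambda>a. Suc (case a of (Q, R) \<Rightarrow> path_size Q + path_size R)) (\<lambda>(Q, R). t ^ pa Q * t ^ pa R)"
    unfolding pa_series_def
    by (rule gen_series_bij[OF bij]) (auto simp: pa_append power_add)
  also have "\<dots> = fps_X * (pa_series t 0 * pa_series t k)"
    unfolding gen_series_size_Suc pa_series_def
    by (subst gen_series_mult) (auto simp: finite_\<N>_path_size)
  finally show ?thesis by (simp add: mult.assoc)
qed

lemma pa_series_eq_power: "pa_series t k = fps_X ^ k * pa_series t 0 ^ Suc k"
  by (induction k) (simp_all add: pa_series_Suc mult_ac)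

lemma pa_series_0_nonempty:
  "pa_series t 0 = 1 + gen_series (\<N> 0 - {[]}) path_size (\<lambda>P. t ^ pa P)"
proof -
  have "pa_series t 0 = gen_series ({[]} \<union> (\<N> 0 - {[]})) path_size (\<lambda>P. t ^ pa P)"
    unfolding pa_series_def by (rule arg_cong[of _ _ "\<lambda>A. gen_series A _ _"]) auto
  also have "\<dots> = 1 + gen_series (\<N> 0 - {[]}) path_size (\<lambda>P. t ^ pa P)"
    by (subst gen_series_Un) (auto simp: gen_series_singleton insert_absorb finite_\<N>_path_size)
  finally show ?thesis .
qed

text \<open>First-return decomposition of a nonempty Dyck path into an elevated path U Q D and a
  Dyck path R.\<close>

lemma pa_series_0_elevate:
  "pa_series t 0 = 1 + fps_X * gen_series (\<N> 0) path_size (\<lambda>Q. t ^ pa (U # Q @ [D])) * pa_series t 0"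
proof -
  let ?h = "\<lambda>(Q, R). (U # Q @ [D]) @ R"
  have elev: "U # Q @ [D] \<in> \<N> 0" if "Q \<in> \<N> 0" for Q
    using append_in_\<N>[OF that, of "[D]" 1] by simp
  have bij: "bij_betw ?h (\<N> 0 \<times> \<N> 0) (\<N> 0 - {[]})"
    unfolding bij_betw_def
  proof
    show "inj_on ?h (\<N> 0 \<times> \<N> 0)"
      by (auto simp: inj_on_def dest: \<N>_split_unique)
    show "?h ` (\<N> 0 \<times> \<N> 0) = \<N> 0 - {[]}"
    proof (intro equalityI subsetI)
      fix P assume P: "P \<in> \<N> 0 - {[]}"
      then obtain P' where P': "P = U # P'" "P' \<in> \<N> (Suc 0)"
        by (cases P; cases "hd P") auto
      from P'(2) obtain Q R where "Q \<in> \<N> 0" "R \<in> \<N> 0" "P' = Q @ D # R"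
        by (rule \<N>_Suc_split)
      with P' show "P \<in> ?h ` (\<N> 0 \<times> \<N> 0)" by force
    next
      fix P assume "P \<in> ?h ` (\<N> 0 \<times> \<N> 0)"
      then obtain Q R where QR: "Q \<in> \<N> 0" "R \<in> \<N> 0" "P = (U # Q @ [D]) @ R" by auto
      then show "P \<in> \<N> 0 - {[]}"
        using append_in_\<N>[OF elev[OF QR(1)] QR(2)] by simp
    qed
  qed
  have "pa_series t 0 = 1 + gen_series (\<N> 0 - {[]}) path_size (\<lambda>P. t ^ pa P)"
    by (rule pa_series_0_nonempty)
  also have "gen_series (\<N> 0 - {[]}) path_size (\<lambda>P. t ^ pa P) = gen_series (\<N> 0 \<times> \<N> 0)
      (\<lambda>a. Suc (case a of (Q, R) \<Rightarrow> path_size Q + path_size R))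
      (\<lambda>(Q, R). t ^ pa (U # Q @ [D]) * t ^ pa R)"
    by (rule gen_series_bij[OF bij])
      (auto simp: pa_append[OF elev] power_add simp del: pa_simps append_Cons append_assoc)
  also have "\<dots> = fps_X * (gen_series (\<N> 0) path_size (\<lambda>Q. t ^ pa (U # Q @ [D])) * pa_series t 0)"
    unfolding gen_series_size_Suc pa_series_def
    by (subst gen_series_mult) (auto simp: finite_\<N>_path_size)
  finally show ?thesis by (simp add: mult.assoc)
qed

text \<open>Elevation changes the weight only of the empty path and of paths U^i D^i R with R
  nonempty. The factor \<open>1 - fps_X\<close> clears the denominator of x / (1 - x), the series of
  all U^i D^i with i at least 1.\<close>

lemma gen_series_elevate:
  fixes t :: "'a::comm_ring_1"
  shows "(1 - fps_X) * (gen_series (\<N> 0) path_size (\<lambda>Q. t ^ pa (U # Q @ [D])) - pa_series t 0) =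
    (1 - fps_X) * (fps_const t - 1) + (1 - fps_const t) * fps_X * (pa_series t 0 - 1)"
proof -
  \<comment> \<open>The change of weight under elevation; the sum of \<open>w\<close> is then
    restricted to its support.\<close>
  define w where "w Q = t ^ pa (U # Q @ [D]) - t ^ pa Q" for Q
  let ?h = "\<lambda>(i, R). (replicate i U @ replicate i D) @ R"
  let ?I = "{1::nat..}" and ?A = "?h ` ({1..} \<times> (\<N> 0 - {[]}))"
  let ?K = "gen_series ?I (\<lambda>i. i) (\<lambda>_. 1) :: 'a fps"
  have inj: "inj_on ?h (?I \<times> (\<N> 0 - {[]}))"
  proof (rule inj_onI)
    fix a b
    assume "a \<in> ?I \<times> (\<N> 0 - {[]})" "b \<in> ?I \<times> (\<N> 0 - {[]})" "?h a = ?h b"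
    moreover from this have "fst a = fst b"
      by (intro replicate_UD_inject[of "fst a" "snd a" "fst b" "snd b"]) (auto simp: case_prod_beta)
    ultimately show "a = b"
      by (simp add: case_prod_beta prod_eq_iff)
  qed
  have sub: "insert [] ?A \<subseteq> \<N> 0"
    using append_in_\<N>[OF pyramid_in_\<N>, of _ 0] by auto
  have pyr_ne: "[] \<notin> ?A" by auto
  have "gen_series (\<N> 0) path_size w = gen_series ({[]} \<union> ?A) path_size w"
  proof (rule gen_series_mono_neutral)
    show "{[]} \<union> ?A \<subseteq> \<N> 0" using sub by simp
    fix Q assume Q: "Q \<in> \<N> 0 - ({[]} \<union> ?A)"
    then have "\<not> (\<exists>i\<ge>1. \<exists>R\<in>\<N> 0 - {[]}. Q = (replicate i U @ replicate i D) @ R)"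
      by force
    then show "w Q = 0"
      using Q pa_elevate_eq[of Q] by (simp add: w_def del: pa_simps)
  qed (rule finite_\<N>_path_size)
  also have "\<dots> = gen_series {[]} path_size w + gen_series ?A path_size w"
    by (rule gen_series_Un)
      (use sub pyr_ne in \<open>auto intro!: finite_subset[OF _ finite_\<N>_path_size[of 0]]\<close>)
  \<comment> \<open>The empty path, of weight 1, becomes the pyramid UD, of weight
    \<open>t\<close>.\<close>
  also have "gen_series {[]} path_size w = fps_const t - 1"
  proof -
    have "starts_with_pyramid [U, D]"
      using starts_with_pyramid_elevate[of "[]"] by simp
    moreover have "\<not> starts_with_pyramid []"
      by (auto simp: starts_with_pyramid_def)
    ultimately have "w [] = t - 1" by (simp add: w_def)
    then show ?thesis by (simp add: gen_series_singleton flip: fps_const_sub)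
  qed
  \<comment> \<open>Elevation turns \<open>t ^ Suc (pa R)\<close> into \<open>t ^ pa R\<close>. The
    factor \<open>1\<close> is the weight of the pyramid, giving the product form for
    \<open>gen_series_mult\<close>.\<close>
  also have "gen_series ?A path_size w = gen_series (?I \<times> (\<N> 0 - {[]}))
      (\<lambda>(i, R). i + path_size R) (\<lambda>(i, R). 1 * ((1 - t) * t ^ pa R))"
  proof (rule gen_series_bij)
    show "bij_betw ?h (?I \<times> (\<N> 0 - {[]})) ?A"
      using inj by (simp add: bij_betw_def)
    fix a assume "a \<in> ?I \<times> (\<N> 0 - {[]})"
    then obtain i R where a: "a = (i, R)" "i \<ge> 1" "R \<in> \<N> 0" "R \<noteq> []" by auto
    then show "w (?h a) = (case a of (i, R) \<Rightarrow> 1 * ((1 - t) * t ^ pa R))"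
      unfolding w_def using pa_elevate_pyramid_append[OF a(2-4)] pa_pyramid_append[OF a(2), of R]
      by (simp add: algebra_simps del: pa_simps append_assoc)
  qed auto
  also have "\<dots> = ?K * gen_series (\<N> 0 - {[]}) path_size (\<lambda>R. (1 - t) * t ^ pa R)"
    by (rule gen_series_mult[symmetric])
      (auto intro!: finite_subset[OF _ finite_\<N>_path_size[of 0]])
  also have "gen_series (\<N> 0 - {[]}) path_size (\<lambda>R. (1 - t) * t ^ pa R) =
      (1 - fps_const t) * (pa_series t 0 - 1)"
    by (simp add: gen_series_cmult pa_series_0_nonempty flip: fps_const_sub)
  finally have eq: "gen_series (\<N> 0) path_size w =
    fps_const t - 1 + ?K * ((1 - fps_const t) * (pa_series t 0 - 1))" .
  have K: "(1 - fps_X) * ?K = fps_X"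
  proof (rule fps_ext)
    fix n
    have "{i \<in> ?I. i = m} = (if m = 0 then {} else {m})" for m by auto
    then have nth: "?K $ m = (if m = 0 then 0 else 1)" for m
      by (simp add: gen_series_nth)
    show "((1 - fps_X) * ?K) $ n = fps_X $ n"
      by (cases n) (auto simp: left_diff_distrib nth[unfolded One_nat_def])
  qed
  have diff: "gen_series (\<N> 0) path_size w =
      gen_series (\<N> 0) path_size (\<lambda>Q. t ^ pa (U # Q @ [D])) - pa_series t 0"
    unfolding w_def pa_series_def by (rule gen_series_diff)
  have "(1 - fps_X) * (gen_series (\<N> 0) path_size (\<lambda>Q. t ^ pa (U # Q @ [D])) - pa_series t 0) =
      (1 - fps_X) * (fps_const t - 1) + ((1 - fps_X) * ?K) * ((1 - fps_const t) * (pa_series t 0 - 1))"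
    unfolding diff[symmetric] eq by (simp only: distrib_left mult.assoc)
  then show ?thesis
    unfolding K by (simp add: mult_ac)
qed

lemma pa_series_0_quadratic:
  "(1 - fps_X * fps_const t) * pa_series t 0 =
    1 - fps_X + fps_X * (1 - fps_X * fps_const t) * pa_series t 0 ^ 2"
proof -
  define F x T where "F = pa_series t 0" and "x = (fps_X :: 'a fps)" and "T = fps_const t"
  define H where "H = gen_series (\<N> 0) path_size (\<lambda>Q. t ^ pa (U # Q @ [D]))"
  have 1: "F = 1 + x * H * F"
    unfolding F_def x_def H_def by (rule pa_series_0_elevate)
  have 2: "(1 - x) * (H - F) = (1 - x) * (T - 1) + (1 - T) * x * (F - 1)"
    unfolding F_def x_def H_def T_def by (rule gen_series_elevate)
  have "(1 - x * T) * F = 1 - x + x * (1 - x * T) * F ^ 2"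
  proof -
    \<comment> \<open>The multipliers \<open>1 - x\<close> and \<open>x * F\<close> of the two
      equations are chosen so that \<open>H\<close> cancels.\<close>
    have "(1 - x * T) * F - (1 - x + x * (1 - x * T) * F ^ 2) =
        (1 - x) * (F - (1 + x * H * F)) +
        x * F * ((1 - x) * (H - F) - ((1 - x) * (T - 1) + (1 - T) * x * (F - 1)))"
      by (simp add: algebra_simps power2_eq_square)
    also have "\<dots> = 0"
      using 1 2 by simp
    finally show ?thesis by simp
  qed
  then show ?thesis
    by (simp add: F_def x_def T_def)
qed

section \<open>Evaluation of the run transform\<close>

lemma embed_gen_series_1: "embed (gen_series (\<N> k) path_size (\<lambda>P. 1)) = pa_series 1 k"
proof -
  have "fps_const (of_nat n) = (of_nat n :: rat fps)" for n
    by (rule fps_of_nat)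
  then show ?thesis
    by (intro fps_ext) (simp add: embed_def pa_series_def gen_series_nth)
qed

theorem theorem5:
  fixes k :: nat and f :: "rat fps"
  assumes "f = gen_series (\<N> k) path_size (\<lambda>P. 1)"
  shows "\<Phi> f = gen_series (\<N> k) path_size (\<lambda>P. fps_X ^ pa P)"
proof -
  define u where "u = (1 - X) / (1 - X * Y)"
  define z where "z = X * (1 - X) / (1 - X * Y)"
  define c where "c = (pa_series 1 0 :: rat fps fps)"
  define C where "C = c oo z"
  define W where "W = (pa_series fps_X 0 :: rat fps fps)"
  \<comment> \<open>If the denominator vanished, \<open>divide_one_minus_xy\<close> would give 1 =
    0.\<close>
  have nz: "1 - X * Y \<noteq> 0"
    by (metis divide_one_minus_xy mult_zero_right zero_neq_one)
  have u: "u * (1 - X * Y) = 1 - X"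
    unfolding u_def by (rule divide_one_minus_xy)
  have "z * (1 - X * Y) = X * (1 - X)"
    unfolding z_def by (rule divide_one_minus_xy)
  also have "\<dots> = (X * u) * (1 - X * Y)"
    using u by (simp add: mult.assoc)
  finally have z: "z = X * u"
    using nz by simp
  then have z0: "z $ 0 = 0" by simp
  \<comment> \<open>At \<open>t = 1\<close> both sides of the quadratic share the factor
    \<open>1 - X\<close>; cancelling it leaves the Catalan equation.\<close>
  have "(1 - X) * c = (1 - X) * (1 + X * c ^ 2)"
    using pa_series_0_quadratic[of "1 :: rat fps"] by (simp add: c_def algebra_simps)
  moreover have "1 - X \<noteq> 0"
    by (metis diff_eq_diff_eq diff_self fps_X_neq_one)
  ultimately have c: "c = 1 + X * c ^ 2" by simp
  have C: "C = 1 + z * C ^ 2"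
    unfolding C_def using arg_cong[OF c, of "\<lambda>g. g oo z"] z0
    by (simp add: fps_compose_add_distrib fps_compose_mult_distrib power2_eq_square)
  have "(1 - X * Y) * W = 1 - X + X * (1 - X * Y) * W ^ 2"
    unfolding W_def by (rule pa_series_0_quadratic)
  also have "\<dots> = (1 - X * Y) * (u + X * W ^ 2)"
    unfolding u[symmetric] by (simp only: distrib_left mult_ac)
  finally have "(1 - X * Y) * W = (1 - X * Y) * (u + X * W ^ 2)" .
  with nz have W: "W = u + X * W ^ 2" by simp
  \<comment> \<open>Since \<open>u * z = X * u ^ 2\<close>, multiplying the equation of
    \<open>C\<close> by \<open>u\<close> shows that \<open>u * C\<close> solves the same quadratic
    as \<open>W\<close>. The difference of two solutions factors, and the second factor has constant
    coefficient 1.\<close>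
  have "(u * C - W) * (1 - X * (u * C + W)) = 0"
    using C W z by algebra
  moreover have "1 - X * (u * C + W) \<noteq> 0"
  proof
    assume "1 - X * (u * C + W) = 0"
    then have "(1 - X * (u * C + W)) $ 0 = 0" by (simp only: fps_zero_nth)
    then show False by simp
  qed
  ultimately have uC: "u * C = W" by simp
  have "\<Phi> f = u * (pa_series 1 k oo z)"
    unfolding run_transform_def assms embed_gen_series_1 u_def z_def ..
  also have "pa_series 1 k oo z = z ^ k * C ^ Suc k"
    using z0 by (simp add: pa_series_eq_power[of _ k] c_def[symmetric] C_def
      fps_compose_mult_distrib fps_compose_power[symmetric] del: power_Suc)
  \<comment> \<open>With \<open>z = X * u\<close>, the \<open>k\<close> factors \<open>u\<close>
    from \<open>z ^ k\<close> and the prefactor supply exactly \<open>Suc k\<close> copies, one for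
    each \<open>C\<close>.\<close>
  also have "u * (z ^ k * C ^ Suc k) = X ^ k * (u * C) ^ Suc k"
    by (simp add: z power_mult_distrib mult_ac)
  also have "\<dots> = pa_series fps_X k"
    unfolding uC W_def by (rule pa_series_eq_power[symmetric])
  finally show ?thesis
    by (simp add: pa_series_def)
qed

end
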